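(* There exists a symmetric stable operator $L$ of order $2s$ on $\mathbb{R}^n$ (see context) and a $C^\infty$ bounded domain $\Omega\subset\mathbb{R}^n$ for which $$L(d^s)\notin L^\infty(\Omega),$$ where $d$ is a function that is $C^\infty$ in $\overline\Omega$, satisfies $d\equiv0$ in $\mathbb{R}^n\setminus\Omega$, and coincides with $\mathrm{dist}(x,\mathbb{R}^n\setminus\Omega)$ in a neighborhood of $\partial\Omega$.
   Context: A symmetric stable operator of order $2s$, with $s\in(0,1)$, is an operator $$Lu(x)=\int_{S^{n-1}}\int_{-\infty}^{+\infty}\bigl(u(x+\theta r)+u(x-\theta r)-2u(x)\bigr)\frac{dr}{|r|^{1+2s}}\,d\mu(\theta),$$ where $\mu$ is a nonnegative finite measure on the unit sphere $S^{n-1}$ (the spectral measure) satisfying, for some ellipticity constants $\lambda,\Lambda$, $$0<\lambda\le \inf_{\nu\in S^{n-1}}\int_{S^{n-1}}|\nu\cdot\theta|^{2s}d\mu(\theta),\qquad \int_{S^{n-1}}d\mu\le\Lambda<\infty.$$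
   Formalization: Proved for every s in (0,1) and n at least 2, with d nonnegative; n = 1 is excluded since there L is a multiple of the fractional Laplacian, Ω is an interval, and L(d^s) is bounded for d positive in Ω. *)

theory Defs
  imports "HOL-Analysis.Analysis"
begin

text \<open>\<open>Ck_on k S f\<close>: \<open>f\<close> is of class \<open>C\<^sup>k\<close> on the open set \<open>S\<close>. All partial derivatives of order
  less than \<open>k\<close> are totally differentiable on \<open>S\<close>, and those of order \<open>k\<close> are continuous.\<close>

primrec Ck_on :: "nat \<Rightarrow> 'a::euclidean_space set \<Rightarrow> ('a \<Rightarrow> real) \<Rightarrow> bool" where
  "Ck_on 0 S f \<longleftrightarrow> continuous_on S f"
| "Ck_on (Suc k) S f \<longleftrightarrow>
     (\<forall>x\<in>S. f differentiable (at x)) \<and>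
     (\<forall>b\<in>Basis. Ck_on k S (\<lambda>x. frechet_derivative f (at x) b))"

definition smooth_on :: "'a::euclidean_space set \<Rightarrow> ('a \<Rightarrow> real) \<Rightarrow> bool" where
  "smooth_on S f \<longleftrightarrow> open S \<and> (\<forall>k. Ck_on k S f)"

text \<open>Smoothness up to the boundary: \<open>f\<close> restricted to \<open>K\<close> extends to a smooth function on an open
  neighbourhood of \<open>K\<close>. The values of \<open>f\<close> outside \<open>K\<close> are irrelevant.\<close>

definition smooth_on_closed :: "'a::euclidean_space set \<Rightarrow> ('a \<Rightarrow> real) \<Rightarrow> bool" where
  "smooth_on_closed K f \<longleftrightarrow> (\<exists>U g. K \<subseteq> U \<and> smooth_on U g \<and> (\<forall>x\<in>K. f x = g x))"

text \<open>Near each boundary point \<open>x0\<close> the domain is the strict epigraph, in some direction \<open>\<nu>\<close>, of a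
  smooth function of the component \<open>x - (x \<bullet> \<nu>) \<nu>\<close> orthogonal to \<open>\<nu>\<close>. That component ranges over
  (part of) the ball on which \<open>\<gamma>\<close> is required to be smooth.\<close>

definition smooth_bounded_domain :: "'a::euclidean_space set \<Rightarrow> bool" where
  "smooth_bounded_domain \<Omega> \<longleftrightarrow>
     open \<Omega> \<and> connected \<Omega> \<and> bounded \<Omega> \<and> \<Omega> \<noteq> {} \<and>
     (\<forall>x0\<in>frontier \<Omega>. \<exists>r \<nu> \<gamma>.
        0 < r \<and> norm \<nu> = 1 \<and>
        smooth_on (ball (x0 - (x0 \<bullet> \<nu>) *\<^sub>R \<nu>) r) \<gamma> \<and>
        \<Omega> \<inter> ball x0 r = {x \<in> ball x0 r. \<gamma> (x - (x \<bullet> \<nu>) *\<^sub>R \<nu>) < x \<bullet> \<nu>})"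

text \<open>A spectral measure is a finite Borel measure whose underlying space is the unit sphere itself.
  The two conjuncts after the \<open>\<sigma>\<close>-algebra and finiteness are the ellipticity conditions.\<close>

definition spectral_measure ::
    "real \<Rightarrow> real \<Rightarrow> real \<Rightarrow> 'a::euclidean_space measure \<Rightarrow> bool" where
  "spectral_measure s lam Lam \<mu> \<longleftrightarrow>
     sets \<mu> = sets (restrict_space borel (sphere 0 1)) \<and> finite_measure \<mu> \<and>
     0 < lam \<and>
     lam \<le> (INF \<nu>\<in>sphere 0 1. (LINT \<theta>|\<mu>. \<bar>\<nu> \<bullet> \<theta>\<bar> powr (2 * s))) \<and>
     measure \<mu> (sphere 0 1) \<le> Lam"

text \<open>The symmetric stable operator of order \<open>2 s\<close> with spectral measure \<open>\<mu>\<close>. Integrals are absolutely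
  convergent Lebesgue integrals; where one does not converge absolutely, it has the value 0.\<close>

definition stable_operator ::
    "real \<Rightarrow> 'a::euclidean_space measure \<Rightarrow> ('a \<Rightarrow> real) \<Rightarrow> 'a \<Rightarrow> real" where
  "stable_operator s \<mu> u x =
     (LINT \<theta>|\<mu>. (LINT r|lborel.
        (u (x + r *\<^sub>R \<theta>) + u (x - r *\<^sub>R \<theta>) - 2 * u x) / \<bar>r\<bar> powr (1 + 2 * s)))"

text \<open>The functions \<open>d\<close> to which the result applies. Nonnegativity makes the power \<open>d\<^sup>s\<close> meaningful;
  \<^term>\<open>infdist x (- \<Omega>)\<close> is the distance from \<open>x\<close> to the complement of \<open>\<Omega>\<close>.\<close>

definition regularized_distance :: "'a::euclidean_space set \<Rightarrow> ('a \<Rightarrow> real) \<Rightarrow> bool" where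
  "regularized_distance \<Omega> d \<longleftrightarrow>
     (\<forall>x. 0 \<le> d x) \<and>
     smooth_on_closed (closure \<Omega>) d \<and>
     (\<forall>x. x \<notin> \<Omega> \<longrightarrow> d x = 0) \<and>
     (\<exists>V. open V \<and> frontier \<Omega> \<subseteq> V \<and> (\<forall>x\<in>V. d x = infdist x (- \<Omega>)))"

text \<open>Essential boundedness. Measurability is deliberately not part of the definition, so that
  \<open>f \<notin> Linfty S\<close> can never hold merely because \<open>f\<close> is not measurable.\<close>

definition Linfty :: "'a::euclidean_space set \<Rightarrow> ('a \<Rightarrow> real) set" where
  "Linfty S = {f. \<exists>C. AE x in lebesgue_on S. \<bar>f x\<bar> \<le> C}"

end

theory Submission
  imports Defs
begin

text \<open>The domain is the annulus \<open>1 < |x| < 2\<close> and the spectral measure is the sum of the unit masses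
  at the basis vectors, so that \<open>L\<close> is a sum of one-dimensional operators. Let \<open>u = d\<^sup>s\<close>, let \<open>e\<close> be a
  basis vector, and compare \<open>L u\<close> at the points \<open>(1 + \<epsilon>) e\<close> and \<open>(2 - \<epsilon>) e\<close>, at distance \<open>\<epsilon>\<close> from
  the inner and the outer sphere. In direction \<open>e\<close> the second differences of \<open>u\<close> for small \<open>r\<close> are the same
  at both points, so these possibly singular terms cancel up to a bounded error. In a direction \<open>b\<close>
  orthogonal to \<open>e\<close> the second difference is nonpositive at the outer point, but at the inner point it
  is at least \<open>2 ((\<epsilon> + r\<^sup>2/4)\<^sup>s - \<epsilon>\<^sup>s)\<close>, which is of order \<open>r\<^bsup>2s\<^esup>\<close> for \<open>r\<close> above a multiple of
  \<open>\<surd>\<epsilon>\<close>. Divided by \<open>r\<^bsup>1 + 2s\<^esup>\<close> this integrates to a multiple of \<open>log (1/\<epsilon>)\<close>, so \<open>L u\<close> cannot be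
  bounded at both points as \<open>\<epsilon> \<rightarrow> 0\<close>.\<close>

section \<open>Functions of class \<open>C\<^sup>k\<close>\<close>

text \<open>On an open set \<open>f\<close> and \<open>g\<close> agree near each point, so their
  derivatives there coincide. The induction generalises over both functions because its step passes
  to derivatives.\<close>

lemma Ck_on_cong:
  assumes "open S" "\<And>x. x \<in> S \<Longrightarrow> f x = g x" "Ck_on k S f"
  shows "Ck_on k S g"
  using assms(2,3)
proof (induction k arbitrary: f g)
  case 0
  then show ?case using continuous_on_cong[of S S f g] by simp
next
  case (Suc k)
  have d: "(g has_derivative frechet_derivative f (at x)) (at x)" if "x \<in> S" for x
    using Suc.prems that assms(1)
    by (intro has_derivative_transform_within_open[of f _ x UNIV S g])
       (auto simp: frechet_derivative_works)
  have eq: "frechet_derivative g (at x) = frechet_derivative f (at x)" if "x \<in> S" for x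
    using frechet_derivative_at[OF d[OF that]] by simp
  show ?case
  proof -
    have "Ck_on k S (\<lambda>x. frechet_derivative g (at x) b)" if "b \<in> Basis" for b
      by (rule Suc.IH[of "\<lambda>x. frechet_derivative f (at x) b"]) (use Suc.prems eq that in auto)
    then show ?thesis using d by (auto simp: differentiable_def)
  qed
qed

lemma Ck_on_subset:
  assumes "Ck_on k S f" "T \<subseteq> S"
  shows "Ck_on k T f"
  using assms by (induction k arbitrary: f) (auto intro: continuous_on_subset)

lemma Ck_on_SucD: "Ck_on (Suc k) S f \<Longrightarrow> Ck_on k S f"
proof (induction k arbitrary: f)
  case 0
  then show ?case
    by (auto intro!: continuous_at_imp_continuous_on differentiable_imp_continuous_within)
next
  case (Suc k)
  then show ?case by auto
qed

text \<open>By uniqueness of derivatives any explicit \<open>f'\<close> may stand in for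
  \<open>frechet_derivative\<close>; the closure rules below work with such formulas only.\<close>

lemma Ck_on_SucI:
  assumes "open S"
    and "\<And>x. x \<in> S \<Longrightarrow> (f has_derivative f' x) (at x)"
    and "\<And>b. b \<in> Basis \<Longrightarrow> Ck_on k S (\<lambda>x. f' x b)"
  shows "Ck_on (Suc k) S f"
proof -
  have "frechet_derivative f (at x) = f' x" if "x \<in> S" for x
    using frechet_derivative_at[OF assms(2)[OF that]] by simp
  then have "Ck_on k S (\<lambda>x. frechet_derivative f (at x) b)" if "b \<in> Basis" for b
    using Ck_on_cong[OF assms(1) _ assms(3)[OF that], of "\<lambda>x. frechet_derivative f (at x) b"] by simp
  then show ?thesis
    using assms(2) by (auto simp: differentiable_def)
qed

lemma Ck_on_SucE:
  assumes "Ck_on (Suc k) S f"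
  obtains f' where "\<And>x. x \<in> S \<Longrightarrow> (f has_derivative f' x) (at x)"
    and "\<And>b. b \<in> Basis \<Longrightarrow> Ck_on k S (\<lambda>x. f' x b)"
  using assms that[of "\<lambda>x. frechet_derivative f (at x)"] by (auto simp: frechet_derivative_works)

lemma Ck_on_const: "Ck_on k S (\<lambda>x. c)"
  by (induction k arbitrary: c) auto

lemma Ck_on_inner: "open S \<Longrightarrow> Ck_on k S (\<lambda>x. x \<bullet> a)"
proof (cases k)
  case 0
  then show ?thesis by (auto intro: continuous_intros)
next
  case (Suc j)
  assume "open S"
  then show ?thesis
    unfolding Suc
    by (rule Ck_on_SucI[where f'="\<lambda>x h. h \<bullet> a"]) (auto intro: derivative_eq_intros Ck_on_const)
qed

lemma Ck_on_add:
  assumes "open S" "Ck_on k S f" "Ck_on k S g"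
  shows "Ck_on k S (\<lambda>x. f x + g x)"
  using assms(2,3)
proof (induction k arbitrary: f g)
  case 0
  then show ?case by (simp add: continuous_on_add)
next
  case (Suc k)
  from Suc.prems obtain f' g' where
    "\<And>x. x \<in> S \<Longrightarrow> (f has_derivative f' x) (at x)" "\<And>b. b \<in> Basis \<Longrightarrow> Ck_on k S (\<lambda>x. f' x b)"
    "\<And>x. x \<in> S \<Longrightarrow> (g has_derivative g' x) (at x)" "\<And>b. b \<in> Basis \<Longrightarrow> Ck_on k S (\<lambda>x. g' x b)"
    by (elim Ck_on_SucE) (rule that)
  then show ?case
    using assms(1) by (intro Ck_on_SucI[where f'="\<lambda>x h. f' x h + g' x h"] Suc.IH) (auto intro: has_derivative_add)
qed

lemma Ck_on_mult:
  assumes "open S" "Ck_on k S f" "Ck_on k S g"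
  shows "Ck_on k S (\<lambda>x. f x * g x)"
  using assms(2,3)
proof (induction k arbitrary: f g)
  case 0
  then show ?case by (simp add: continuous_on_mult)
next
  case (Suc k)
  from Suc.prems obtain f' g' where
    "\<And>x. x \<in> S \<Longrightarrow> (f has_derivative f' x) (at x)" "\<And>b. b \<in> Basis \<Longrightarrow> Ck_on k S (\<lambda>x. f' x b)"
    "\<And>x. x \<in> S \<Longrightarrow> (g has_derivative g' x) (at x)" "\<And>b. b \<in> Basis \<Longrightarrow> Ck_on k S (\<lambda>x. g' x b)"
    by (elim Ck_on_SucE) (rule that)
  then show ?case
    \<comment> \<open>The product rule keeps \<open>f\<close> and \<open>g\<close> as factors, so
      both are first lowered to class \<open>k\<close> for the induction hypothesis.\<close>
    using assms(1) Suc.prems[THEN Ck_on_SucD]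
    by (intro Ck_on_SucI[where f'="\<lambda>x h. f x * g' x h + f' x h * g x"] Ck_on_add Suc.IH)
       (auto intro: has_derivative_mult)
qed

lemma Ck_on_sum:
  assumes "open S" "\<And>i. i \<in> I \<Longrightarrow> Ck_on k S (f i)"
  shows "Ck_on k S (\<lambda>x. \<Sum>i\<in>I. f i x)"
  using assms(2) by (induction I rule: infinite_finite_induct) (auto intro: Ck_on_const Ck_on_add assms(1))

lemma Ck_on_diff:
  assumes "open S" "Ck_on k S f" "Ck_on k S g"
  shows "Ck_on k S (\<lambda>x. f x - g x)"
  using Ck_on_add[OF assms(1,2) Ck_on_mult[OF assms(1) Ck_on_const[of k S "-1"] assms(3)]] by simp

text \<open>A set of real functions on \<open>T\<close> that is stable under differentiation consists of smooth
  functions; this replaces the explicit computation of iterated derivatives.\<close>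

lemma Ck_on_compose:
  fixes \<phi> :: "real \<Rightarrow> real"
  assumes "open S" "Ck_on k S f" "f ` S \<subseteq> T" "\<phi> \<in> F"
    and F: "\<And>\<phi>. \<phi> \<in> F \<Longrightarrow> \<exists>\<phi>'\<in>F. \<forall>t\<in>T. (\<phi> has_real_derivative \<phi>' t) (at t)"
  shows "Ck_on k S (\<lambda>x. \<phi> (f x))"
  using assms(2,4)
proof (induction k arbitrary: \<phi>)
  case 0
  have "continuous_on T \<phi>"
    using F[OF 0(2)] by (meson DERIV_isCont continuous_at_imp_continuous_on)
  then show ?case
    using 0 assms(3) by (auto intro: continuous_on_compose2)
next
  case (Suc k)
  from Suc.prems obtain f' where f':
    "\<And>x. x \<in> S \<Longrightarrow> (f has_derivative f' x) (at x)" "\<And>b. b \<in> Basis \<Longrightarrow> Ck_on k S (\<lambda>x. f' x b)"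
    by (elim Ck_on_SucE) (rule that)
  obtain \<phi>' where \<phi>': "\<phi>' \<in> F" "\<And>t. t \<in> T \<Longrightarrow> (\<phi> has_real_derivative \<phi>' t) (at t)"
    using F[OF Suc.prems(2)] by auto
  have "((\<lambda>x. \<phi> (f x)) has_derivative (\<lambda>h. \<phi>' (f x) * f' x h)) (at x)" if "x \<in> S" for x
    using has_derivative_compose[OF f'(1)[OF that], of \<phi>] \<phi>'(2)[of "f x"] that assms(3)
    by (auto simp: has_field_derivative_def)
  then show ?case
    using assms(1) f'(2) Suc.IH[OF Ck_on_SucD[OF Suc.prems(1)] \<phi>'(1)]
    by (intro Ck_on_SucI[where f'="\<lambda>x h. \<phi>' (f x) * f' x h"] Ck_on_mult) auto
qed

lemma Ck_on_powr:
  assumes "open S" "Ck_on k S f" "\<And>x. x \<in> S \<Longrightarrow> 0 < f x"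
  shows "Ck_on k S (\<lambda>x. f x powr a)"
\<comment> \<open>Leaving both the factor and the exponent free makes the family of powers stable
  under differentiation.\<close>
proof (rule Ck_on_compose[where T="{0<..}" and F="{\<lambda>t. c * t powr a |c a. True}" and \<phi>="\<lambda>t. t powr a"])
  show "(\<lambda>t. t powr a) \<in> {\<lambda>t. c * t powr a |c a. True}"
    by (intro CollectI exI[of _ 1] exI[of _ a]) simp
  fix \<phi> :: "real \<Rightarrow> real" assume "\<phi> \<in> {\<lambda>t. c * t powr a |c a. True}"
  then obtain c a where \<phi>: "\<phi> = (\<lambda>t. c * t powr a)" by auto
  have "(\<phi> has_real_derivative c * a * t powr (a - 1)) (at t)" if "t > 0" for t
    unfolding \<phi> using that by (auto intro!: derivative_eq_intros simp: powr_diff field_simps)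
  then show "\<exists>\<phi>'\<in>{\<lambda>t. c * t powr a |c a. True}. \<forall>t\<in>{0<..}. (\<phi> has_real_derivative \<phi>' t) (at t)"
    by (intro bexI[of _ "\<lambda>t. (c * a) * t powr (a - 1)"]) auto
qed (use assms in auto)

lemma Ck_on_sqrt:
  assumes "open S" "Ck_on k S f" "\<And>x. x \<in> S \<Longrightarrow> 0 < f x"
  shows "Ck_on k S (\<lambda>x. sqrt (f x))"
  by (rule Ck_on_cong[OF assms(1) _ Ck_on_powr[OF assms, of "1/2"]])
     (use assms(3) in \<open>auto simp: powr_half_sqrt less_imp_le\<close>)

lemma Ck_on_divide:
  assumes "open S" "Ck_on k S f" "Ck_on k S g" "\<And>x. x \<in> S \<Longrightarrow> 0 < g x"
  shows "Ck_on k S (\<lambda>x. f x / g x)"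
  by (rule Ck_on_cong[OF assms(1) _ Ck_on_mult[OF assms(1,2) Ck_on_powr[OF assms(1,3,4), of "-1"]]])
     (use assms(4) in \<open>auto simp: powr_minus less_imp_le divide_inverse\<close>)

lemma Ck_on_norm_square: "open S \<Longrightarrow> Ck_on k S (\<lambda>x. (norm x)\<^sup>2)"
  unfolding power2_norm_eq_inner by (subst euclidean_inner) (intro Ck_on_sum Ck_on_mult Ck_on_inner)

lemma Ck_on_norm:
  assumes "open S" "0 \<notin> S"
  shows "Ck_on k S norm"
  by (rule Ck_on_cong[OF assms(1) _ Ck_on_sqrt[OF assms(1) Ck_on_norm_square[OF assms(1)]]])
     (use assms in auto)

section \<open>Flat functions for smooth cutoffs\<close>

definition flat :: "real poly \<Rightarrow> real \<Rightarrow> real" where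
  "flat p t = (if 0 < t then poly p (1 / t) * exp (- (1 / t)) else 0)"

lemma tendsto_poly_exp_at_top: "((\<lambda>x. poly p x * exp (- x)) \<longlongrightarrow> 0) (at_top :: real filter)"
proof -
  have "((\<lambda>x. coeff p i * (x ^ i * exp (- x))) \<longlongrightarrow> coeff p i * 0) (at_top :: real filter)" for i
    using tendsto_power_div_exp_0[of i]
    by (intro tendsto_mult tendsto_const) (simp add: exp_minus field_simps)
  then have "((\<lambda>x. \<Sum>i\<le>degree p. coeff p i * (x ^ i * exp (- x))) \<longlongrightarrow> (\<Sum>i\<le>degree p. coeff p i * 0)) (at_top :: real filter)"
    by (intro tendsto_sum) auto
  then show ?thesis
    by (simp add: poly_altdef sum_distrib_right mult.assoc)
qed

lemma flat_div_tendsto_0: "((\<lambda>t. flat p t / t) \<longlongrightarrow> 0) (at 0)"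
proof (rule filterlim_split_at)
  show "((\<lambda>t. flat p t / t) \<longlongrightarrow> 0) (at_left 0)"
    by (rule tendsto_eventually) (auto simp: flat_def eventually_at_filter)
  \<comment> \<open>With x = 1/t the division by t becomes a factor x, and \<open>pCons 0 p\<close>
    is the polynomial x p(x).\<close>
  have "((\<lambda>t. poly (pCons 0 p) (inverse t) * exp (- inverse t)) \<longlongrightarrow> 0) (at_right (0::real))"
    by (rule filterlim_compose[OF tendsto_poly_exp_at_top filterlim_inverse_at_top_right])
  then show "((\<lambda>t. flat p t / t) \<longlongrightarrow> 0) (at_right 0)"
    by (rule Lim_transform_eventually) (auto simp: flat_def eventually_at_filter field_simps)
qed

text \<open>For t > 0 the exponential contributes p(1/t)/t^2 and the polynomial -p'(1/t)/t^2, whence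
  x^2 (p - p'). At 0 the difference quotient is \<open>flat p t / t\<close>. So
  \<open>range flat\<close> is stable under differentiation, as \<open>Ck_on_compose\<close>
  requires.\<close>

lemma flat_has_derivative:
  "(flat p has_real_derivative flat (monom 1 2 * (p - pderiv p)) t) (at t)"
proof -
  consider "t < 0" | "t = 0" | "t > 0" by linarith
  then show ?thesis
  proof cases
    case 1
    then have "((\<lambda>_. 0) has_real_derivative 0) (at t)" by auto
    then have "(flat p has_real_derivative 0) (at t)"
      by (rule DERIV_cong_ev[THEN iffD1, rotated -1])
         (use 1 in \<open>auto simp: flat_def intro!: eventually_mono[OF eventually_nhds_in_open[of "{..<0}"]]\<close>)
    then show ?thesis using 1 by (simp add: flat_def)
  next
    case 2
    then show ?thesis
      using flat_div_tendsto_0[of p] by (simp add: DERIV_def flat_def)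
  next
    case 3
    have "((\<lambda>t. poly p (1 / t) * exp (- (1 / t))) has_real_derivative flat (monom 1 2 * (p - pderiv p)) t) (at t)"
      using 3 by (auto intro!: derivative_eq_intros DERIV_chain'[of "\<lambda>t. 1/t" _ t UNIV "poly p"] poly_DERIV
        simp: flat_def poly_monom field_simps power2_eq_square)
    then show ?thesis
      by (rule DERIV_cong_ev[THEN iffD1, rotated -1])
         (use 3 in \<open>auto simp: flat_def intro!: eventually_mono[OF eventually_nhds_in_open[of "{0<..}"]]\<close>)
  qed
qed

lemma Ck_on_flat:
  assumes "open S" "Ck_on k S f"
  shows "Ck_on k S (\<lambda>x. flat p (f x))"
  by (rule Ck_on_compose[OF assms, where T=UNIV and F="range flat"])
     (use flat_has_derivative in blast)+

section \<open>The annulus\<close>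

definition annulus :: "'a::euclidean_space set" where
  "annulus = {x. 1 < norm x \<and> norm x < 2}"

lemma open_annulus: "open annulus"
  unfolding annulus_def by (intro open_Collect_conj open_Collect_less continuous_intros)

lemma bounded_annulus: "bounded annulus"
  by (rule bounded_subset[of "ball 0 2"]) (auto simp: annulus_def)

lemma closure_annulus_subset: "closure annulus \<subseteq> {x. 1 \<le> norm x \<and> norm x \<le> 2}"
  by (rule closure_minimal)
     (auto simp: annulus_def intro!: closed_Collect_conj closed_Collect_le continuous_intros)

lemma frontier_annulus_subset: "frontier annulus \<subseteq> {x. norm x = 1 \<or> norm x = 2}"
  using closure_annulus_subset interior_open[OF open_annulus] unfolding frontier_def
  by (force simp: annulus_def)

lemma frontier_annulusI:
  assumes "norm x = 1 \<or> norm x = 2"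
  shows "x \<in> frontier annulus"
proof -
  \<comment> \<open>The sign \<open>c\<close> makes the radial motion enter the annulus: outwards
    from radius 1, inwards from radius 2.\<close>
  define c :: real where "c = (if norm x = 1 then 1 else -1)"
  have "((\<lambda>t. (1 + c * t) *\<^sub>R x) \<longlongrightarrow> (1 + c * 0) *\<^sub>R x) (at_right (0::real))"
    by (intro tendsto_intros)
  moreover have "\<forall>\<^sub>F t in at_right (0::real). (1 + c * t) *\<^sub>R x \<in> closure annulus"
    unfolding eventually_at_right_field
  proof (intro exI[of _ "1/2"] conjI allI impI)
    fix t :: real assume "0 < t" "t < 1/2"
    then show "(1 + c * t) *\<^sub>R x \<in> closure annulus"
      using assms by (intro closure_subset[THEN subsetD]) (auto simp: annulus_def c_def)
  qed simp
  ultimately have "x \<in> closure annulus"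
    using Lim_in_closed_set[of "closure annulus" "\<lambda>t. (1 + c * t) *\<^sub>R x" "at_right 0" x] by simp
  then show ?thesis
    using assms by (auto simp: frontier_def interior_open[OF open_annulus]) (auto simp: annulus_def)
qed

section \<open>Distance to the complement of the annulus\<close>

lemma le_infdist:
  assumes "A \<noteq> {}" "\<And>y. y \<in> A \<Longrightarrow> c \<le> dist x y"
  shows "c \<le> infdist x A"
  using assms by (simp add: infdist_notempty cINF_greatest)

text \<open>Radial projection to the unit sphere gives the upper bound, the reverse triangle
  inequality the lower one. Against points beyond radius 2 the latter uses
  \<open>norm x \<le> 3/2\<close>, that is, 2 - |x| is at least |x| - 1.\<close>

lemma infdist_annulus_inner:
  fixes x :: "'a::euclidean_space"
  assumes "norm x \<le> 3/2"
  shows "infdist x (- annulus) = max 0 (norm x - 1)"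
proof (cases "norm x \<le> 1")
  case True
  then show ?thesis by (simp add: annulus_def)
next
  case False
  show ?thesis
  proof (rule antisym)
    have "infdist x (- annulus) \<le> dist x ((1 / norm x) *\<^sub>R x)"
      using False by (intro infdist_le) (auto simp: annulus_def)
    also have "\<dots> = norm ((1 - 1 / norm x) *\<^sub>R x)"
      by (simp add: dist_norm scaleR_left_diff_distrib)
    also have "\<dots> = \<bar>1 - 1 / norm x\<bar> * norm x" by (rule norm_scaleR)
    also have "\<dots> = (1 - 1 / norm x) * norm x"
      using False by (subst abs_of_nonneg) (simp_all add: divide_le_eq_1)
    also have "\<dots> = norm x - 1"
      using False by (auto simp: left_diff_distrib)
    finally show "infdist x (- annulus) \<le> max 0 (norm x - 1)" by simp
    have "norm x - 1 \<le> infdist x (- annulus)"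
    proof (rule le_infdist)
      show "- annulus \<noteq> ({} :: 'a set)" by (rule ex_in_conv[THEN iffD1], rule exI[of _ 0]) (simp add: annulus_def)
      fix y :: 'a assume "y \<in> - annulus"
      then show "norm x - 1 \<le> dist x y"
        using assms norm_triangle_ineq2[of x y] norm_triangle_ineq2[of y x]
        by (auto simp: annulus_def dist_norm norm_minus_commute)
    qed
    then show "max 0 (norm x - 1) \<le> infdist x (- annulus)"
      by (simp add: infdist_nonneg)
  qed
qed

lemma infdist_annulus_outer:
  fixes x :: "'a::euclidean_space"
  assumes "3/2 \<le> norm x"
  shows "infdist x (- annulus) = max 0 (2 - norm x)"
proof (cases "2 \<le> norm x")
  case True
  then show ?thesis by (simp add: annulus_def)
next
  case False
  show ?thesis
  proof (rule antisym)
    have "infdist x (- annulus) \<le> dist x ((2 / norm x) *\<^sub>R x)"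
      using assms by (intro infdist_le) (auto simp: annulus_def)
    also have "\<dots> = norm ((1 - 2 / norm x) *\<^sub>R x)"
      by (simp add: dist_norm scaleR_left_diff_distrib)
    also have "\<dots> = \<bar>1 - 2 / norm x\<bar> * norm x" by (rule norm_scaleR)
    also have "\<dots> = (2 / norm x - 1) * norm x"
      using False assms by (subst abs_of_nonpos) (auto simp: le_divide_eq)
    also have "\<dots> = 2 - norm x"
      using assms by (auto simp: left_diff_distrib)
    finally show "infdist x (- annulus) \<le> max 0 (2 - norm x)" by simp
    have "2 - norm x \<le> infdist x (- annulus)"
    proof (rule le_infdist)
      show "- annulus \<noteq> ({} :: 'a set)" by (rule ex_in_conv[THEN iffD1], rule exI[of _ 0]) (simp add: annulus_def)
      fix y :: 'a assume "y \<in> - annulus"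
      then show "2 - norm x \<le> dist x y"
        using assms norm_triangle_ineq2[of x y] norm_triangle_ineq2[of y x]
        by (auto simp: annulus_def dist_norm norm_minus_commute)
    qed
    then show "max 0 (2 - norm x) \<le> infdist x (- annulus)"
      by (simp add: infdist_nonneg)
  qed
qed

section \<open>Graph charts for the two boundary spheres\<close>

lemma norm_orthogonal_decomposition:
  fixes x \<nu> :: "'a::euclidean_space"
  assumes "norm \<nu> = 1"
  shows "(norm x)\<^sup>2 = (norm (x - (x \<bullet> \<nu>) *\<^sub>R \<nu>))\<^sup>2 + (x \<bullet> \<nu>)\<^sup>2"
proof -
  have "\<nu> \<bullet> \<nu> = 1" using assms by (simp add: norm_eq_1)
  then show ?thesis
    unfolding power2_norm_eq_inner
    by (simp add: inner_diff_left inner_diff_right inner_commute power2_eq_square)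
qed

text \<open>Supplies the charts: upper cap of the unit sphere with \<open>c = 1\<close>, lower cap
  of the sphere of radius 2 with \<open>c = -1\<close>.\<close>

lemma smooth_sqrt_cap:
  fixes S :: "'a::euclidean_space set"
  assumes "open S" "\<And>x. x \<in> S \<Longrightarrow> norm x < R"
  shows "smooth_on S (\<lambda>x. c * sqrt (R\<^sup>2 - (norm x)\<^sup>2))"
proof -
  have "0 < R\<^sup>2 - (norm x)\<^sup>2" if "x \<in> S" for x
    using power_strict_mono[OF assms(2)[OF that], of 2] by simp
  then show ?thesis
    unfolding smooth_on_def using assms(1)
    by (intro conjI allI Ck_on_mult Ck_on_const Ck_on_sqrt Ck_on_diff Ck_on_norm_square)
qed

lemma smooth_bounded_domain_annulus:
  assumes "2 \<le> DIM('a::euclidean_space)"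
  shows "smooth_bounded_domain (annulus :: 'a set)"
proof -
  have connected: "connected (annulus :: 'a set)"
    using connected_annulus(1)[OF assms, of 1 0 2] by (simp add: annulus_def)
  obtain b :: 'a where "b \<in> Basis" using nonempty_Basis by blast
  then have nonempty: "(annulus :: 'a set) \<noteq> {}"
    by (auto simp: annulus_def intro!: exI[of _ "(3/2) *\<^sub>R b"])
  have chart: "\<exists>r \<nu> \<gamma>. 0 < r \<and> norm \<nu> = 1 \<and>
        smooth_on (ball (x0 - (x0 \<bullet> \<nu>) *\<^sub>R \<nu>) r) \<gamma> \<and>
        annulus \<inter> ball x0 r = {x \<in> ball x0 r. \<gamma> (x - (x \<bullet> \<nu>) *\<^sub>R \<nu>) < x \<bullet> \<nu>}"
    if x0: "x0 \<in> frontier annulus" for x0 :: 'a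
  proof -
    consider "norm x0 = 1" | "norm x0 = 2" using x0 frontier_annulus_subset by auto
    then show ?thesis
    proof cases
      case 1
      have x0x0: "x0 \<bullet> x0 = 1" using 1 by (simp add: norm_eq_1)
      \<comment> \<open>At the inner sphere the outward radial direction \<open>x0\<close> points
        into the annulus. Radius 1/2 keeps the outer sphere out of reach and
        \<open>x \<bullet> x0\<close> positive, so the graph inequality may be squared.\<close>
      have "annulus \<inter> ball x0 (1/2) = {x \<in> ball x0 (1/2). 1 * sqrt (1\<^sup>2 - (norm (x - (x \<bullet> x0) *\<^sub>R x0))\<^sup>2) < x \<bullet> x0}"
      proof -
        have "x \<in> annulus \<longleftrightarrow> 1 * sqrt (1\<^sup>2 - (norm (x - (x \<bullet> x0) *\<^sub>R x0))\<^sup>2) < x \<bullet> x0"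
          if x: "dist x0 x < 1/2" for x
        proof -
          have "norm x < 2"
            using x 1 norm_triangle_ineq2[of x x0] by (simp add: dist_norm norm_minus_commute)
          have "\<bar>(x0 - x) \<bullet> x0\<bar> < 1/2"
            using Cauchy_Schwarz_ineq2[of "x0 - x" x0] x 1 by (simp add: dist_norm)
          then have pos: "0 < x \<bullet> x0" unfolding inner_diff_left x0x0 by linarith
          have "sqrt (1\<^sup>2 - (norm (x - (x \<bullet> x0) *\<^sub>R x0))\<^sup>2) < x \<bullet> x0
              \<longleftrightarrow> sqrt (1\<^sup>2 - (norm (x - (x \<bullet> x0) *\<^sub>R x0))\<^sup>2) < sqrt ((x \<bullet> x0)\<^sup>2)"
            using pos by simp
          also have "\<dots> \<longleftrightarrow> 1\<^sup>2 < (norm x)\<^sup>2"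
            using norm_orthogonal_decomposition[OF 1, of x] unfolding real_sqrt_less_iff by linarith
          also have "\<dots> \<longleftrightarrow> 1 < norm x"
            using power_less_imp_less_base[of 1 2 "norm x"] power_strict_mono[of 1 "norm x" 2] by auto
          finally show ?thesis
            using \<open>norm x < 2\<close> by (simp add: annulus_def)
        qed
        then show ?thesis by auto
      qed
      then show ?thesis
        using 1 x0x0
        by (intro exI[of _ "1/2"] exI[of _ x0] exI[of _ "\<lambda>x. 1 * sqrt (1\<^sup>2 - (norm x)\<^sup>2)"] conjI smooth_sqrt_cap) auto
    next
      case 2
      \<comment> \<open>At the outer sphere the annulus lies on the side of the centre, so the chart
        direction is reversed and \<open>x \<bullet> \<nu>\<close> is negative.\<close>
      define \<nu> where "\<nu> = - (1/2) *\<^sub>R x0"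
      have \<nu>: "norm \<nu> = 1" and x0: "x0 = - 2 *\<^sub>R \<nu>" using 2 by (auto simp: \<nu>_def)
      have \<nu>\<nu>: "\<nu> \<bullet> \<nu> = 1" using \<nu> by (simp add: norm_eq_1)
      have "annulus \<inter> ball x0 (1/2) = {x \<in> ball x0 (1/2). (-1) * sqrt (2\<^sup>2 - (norm (x - (x \<bullet> \<nu>) *\<^sub>R \<nu>))\<^sup>2) < x \<bullet> \<nu>}"
      proof -
        have "x \<in> annulus \<longleftrightarrow> (-1) * sqrt (2\<^sup>2 - (norm (x - (x \<bullet> \<nu>) *\<^sub>R \<nu>))\<^sup>2) < x \<bullet> \<nu>"
          if x: "dist x0 x < 1/2" for x
        proof -
          have "1 < norm x"
            using x 2 norm_triangle_ineq2[of x0 x] by (simp add: dist_norm norm_minus_commute)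
          have "\<bar>(x0 - x) \<bullet> \<nu>\<bar> < 1/2"
            using Cauchy_Schwarz_ineq2[of "x0 - x" \<nu>] x \<nu> by (simp add: dist_norm)
          then have neg: "x \<bullet> \<nu> < 0" unfolding inner_diff_left x0 inner_scaleR_left \<nu>\<nu> by linarith
          have "- sqrt (2\<^sup>2 - (norm (x - (x \<bullet> \<nu>) *\<^sub>R \<nu>))\<^sup>2) < x \<bullet> \<nu>
              \<longleftrightarrow> sqrt ((x \<bullet> \<nu>)\<^sup>2) < sqrt (2\<^sup>2 - (norm (x - (x \<bullet> \<nu>) *\<^sub>R \<nu>))\<^sup>2)"
            using neg by auto
          also have "\<dots> \<longleftrightarrow> (norm x)\<^sup>2 < 2\<^sup>2"
            using norm_orthogonal_decomposition[OF \<nu>, of x] unfolding real_sqrt_less_iff by linarith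
          also have "\<dots> \<longleftrightarrow> norm x < 2"
            using power_less_imp_less_base[of "norm x" 2 2] power_strict_mono[of "norm x" 2 2] by auto
          finally show ?thesis
            using \<open>1 < norm x\<close> by (simp add: annulus_def)
        qed
        then show ?thesis by auto
      qed
      then show ?thesis
        using \<nu> by (intro exI[of _ "1/2"] exI[of _ \<nu>] exI[of _ "\<lambda>x. (-1) * sqrt (2\<^sup>2 - (norm x)\<^sup>2)"] conjI smooth_sqrt_cap)
          (auto simp: x0 \<nu>\<nu>)
    qed
  qed
  show ?thesis
    unfolding smooth_bounded_domain_def
    using open_annulus connected bounded_annulus nonempty chart by blast
qed

text \<open>\<open>\<chi> = flat 1 A / (flat 1 A + flat 1 B)\<close> is a smooth cutoff, so the two branches
  \<open>\<rho> - 1\<close> and \<open>2 - \<rho>\<close> of the distance are glued by a convex combination.\<close>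

lemma regularized_distance_annulus_exists: "\<exists>d. regularized_distance (annulus :: 'a::euclidean_space set) d"
proof -
  define A where "A = (\<lambda>x::'a. flat 1 (7/4 - norm x))"
  define B where "B = (\<lambda>x::'a. flat 1 (norm x - 5/4))"
  define g where "g = (\<lambda>x::'a. (A x * (norm x - 1) + B x * (2 - norm x)) / (A x + B x))"
  define d where "d = (\<lambda>x. if x \<in> annulus then g x else 0)"
  \<comment> \<open>\<open>A\<close> is positive below radius 7/4 and \<open>B\<close> above radius
    5/4; these ranges overlap and cover the space.\<close>
  have AB: "0 \<le> A x" "0 \<le> B x" "0 < A x + B x" for x
    by (auto simp: A_def B_def flat_def add_pos_pos add_nonneg_pos add_pos_nonneg)
  have inner: "g x = norm x - 1" if "norm x \<le> 5/4" for x
    using that AB(3)[of x] by (simp add: g_def B_def flat_def)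
  have outer: "g x = 2 - norm x" if "7/4 \<le> norm x" for x
    using that AB(3)[of x] by (simp add: g_def A_def flat_def)
  have S: "open (- {0::'a})" by auto
  have "Ck_on k (- {0}) g" for k
    unfolding g_def using AB(3) unfolding A_def B_def
    by (intro Ck_on_divide Ck_on_add Ck_on_mult Ck_on_diff Ck_on_flat Ck_on_norm Ck_on_const) auto
  then have smooth: "smooth_on (- {0}) g" by (auto simp: smooth_on_def)
  \<comment> \<open>The bounding spheres are included: there \<open>d\<close> is 0 by definition and
    \<open>g\<close> vanishes as well.\<close>
  have eq: "d x = g x" if "1 \<le> norm x" "norm x \<le> 2" for x
    using that inner[of x] outer[of x] by (auto simp: d_def annulus_def)
  have closed: "smooth_on_closed (closure annulus) d"
    unfolding smooth_on_closed_def
    by (rule exI[of _ "- {0}"], rule exI[of _ g])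
       (use smooth eq closure_annulus_subset[where 'a='a] in auto)
  have nonneg: "0 \<le> d x" for x
    using AB[of x] by (auto simp: d_def g_def annulus_def intro!: divide_nonneg_pos add_nonneg_nonneg mult_nonneg_nonneg)
  define V where "V = {x::'a. norm x < 5/4} \<union> {x. 7/4 < norm x}"
  have "open V"
    unfolding V_def by (intro open_Un open_Collect_less continuous_intros)
  moreover have "frontier annulus \<subseteq> V"
    using frontier_annulus_subset[where 'a='a] by (auto simp: V_def)
  moreover have "d x = infdist x (- annulus)" if "x \<in> V" for x
    using that inner[of x] outer[of x] infdist_annulus_inner[of x] infdist_annulus_outer[of x]
    by (auto simp: V_def d_def annulus_def)
  ultimately show ?thesis
    unfolding regularized_distance_def using nonneg closed
    by (intro exI[of _ d] conjI exI[of _ V]) (auto simp: d_def)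
qed

section \<open>The operator\<close>

text \<open>The counting measure is pushed forward to the Borel sets of the sphere because
  \<open>spectral_measure\<close> fixes that sigma-algebra.\<close>

definition axis_measure :: "'a::euclidean_space measure" where
  "axis_measure = distr (count_space Basis) (restrict_space borel (sphere 0 1)) (\<lambda>b. b)"

lemma measurable_axis: "(\<lambda>b. b) \<in> measurable (count_space Basis) (restrict_space borel (sphere (0::'a::euclidean_space) 1))"
  by (auto simp: measurable_count_space_eq1 space_restrict_space)

lemma integral_axis_measure:
  fixes f :: "'a::euclidean_space \<Rightarrow> real"
  assumes "f \<in> borel_measurable (restrict_space borel (sphere 0 1))"
  shows "(LINT \<theta>|axis_measure. f \<theta>) = (\<Sum>b\<in>Basis. f b)"
  unfolding axis_measure_def
  by (simp add: integral_distr[OF measurable_axis assms] lebesgue_integral_count_space_finite)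

text \<open>The ellipticity constant 1 comes from |t|^(2s) being at least t^2 for |t| at most 1: the
  squared coordinates of a unit vector sum to 1.\<close>

lemma spectral_measure_axis_measure:
  assumes "0 < s" "s < 1"
  shows "spectral_measure s 1 (measure axis_measure (sphere (0::'a::euclidean_space) 1)) (axis_measure :: 'a measure)"
proof -
  have "finite_measure (axis_measure :: 'a measure)"
    unfolding axis_measure_def
    by (intro finite_measure.finite_measure_distr finite_measure_count_space measurable_axis) auto
  moreover have "1 \<le> (LINT \<theta>|axis_measure. \<bar>\<nu> \<bullet> \<theta>\<bar> powr (2 * s))" if "\<nu> \<in> sphere (0::'a) 1" for \<nu>
  proof -
    have "1 = (\<Sum>b\<in>Basis. (\<nu> \<bullet> b)\<^sup>2)"
      using that using euclidean_inner[of \<nu> \<nu>] by (simp add: norm_eq_1 power2_eq_square)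
    also have "\<dots> \<le> (\<Sum>b\<in>Basis. \<bar>\<nu> \<bullet> b\<bar> powr (2 * s))"
    proof (rule sum_mono)
      fix b :: 'a assume "b \<in> Basis"
      then have "\<bar>\<nu> \<bullet> b\<bar> \<le> 1" using Basis_le_norm[of b \<nu>] that by simp
      then show "(\<nu> \<bullet> b)\<^sup>2 \<le> \<bar>\<nu> \<bullet> b\<bar> powr (2 * s)"
        using powr_mono'[of "2 * s" 2 "\<bar>\<nu> \<bullet> b\<bar>"] assms by (cases "\<nu> \<bullet> b = 0") auto
    qed
    also have "\<dots> = (LINT \<theta>|axis_measure. \<bar>\<nu> \<bullet> \<theta>\<bar> powr (2 * s))"
      by (rule integral_axis_measure[symmetric]) (intro measurable_restrict_space1, measurable)
    finally show ?thesis .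
  qed
  moreover have "sphere (0::'a) 1 \<noteq> {}" by simp
  ultimately show ?thesis
    unfolding spectral_measure_def by (auto simp: axis_measure_def intro!: cINF_greatest)
qed

definition second_difference :: "('a::real_vector \<Rightarrow> real) \<Rightarrow> 'a \<Rightarrow> 'a \<Rightarrow> real \<Rightarrow> real" where
  "second_difference u \<theta> x r = u (x + r *\<^sub>R \<theta>) + u (x - r *\<^sub>R \<theta>) - 2 * u x"

lemma second_difference_minus: "second_difference u \<theta> x (- r) = second_difference u \<theta> x r"
  by (simp add: second_difference_def)

lemma stable_operator_axis_measure:
  fixes u :: "'a::euclidean_space \<Rightarrow> real"
  assumes [measurable]: "u \<in> borel_measurable borel"
  shows "stable_operator s axis_measure u x =
    (\<Sum>b\<in>Basis. LINT r|lborel. second_difference u b x r / \<bar>r\<bar> powr (1 + 2 * s))"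
  unfolding stable_operator_def second_difference_def
proof (rule integral_axis_measure)
  \<comment> \<open>Joint measurability gives measurability of the inner integral in \<theta>, the
    hypothesis of \<open>integral_axis_measure\<close>.\<close>
  have "(\<lambda>(\<theta>, r). (u (x + r *\<^sub>R \<theta>) + u (x - r *\<^sub>R \<theta>) - 2 * u x) / \<bar>r\<bar> powr (1 + 2 * s))
      \<in> borel_measurable (borel \<Otimes>\<^sub>M lborel)"
    by measurable
  then show "(\<lambda>\<theta>. LINT r|lborel. (u (x + r *\<^sub>R \<theta>) + u (x - r *\<^sub>R \<theta>) - 2 * u x) / \<bar>r\<bar> powr (1 + 2 * s))
      \<in> borel_measurable (restrict_space borel (sphere 0 1))"
    by (intro measurable_restrict_space1 lborel.borel_measurable_lebesgue_integral)
qed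

section \<open>Second differences of functions of class C^2\<close>

lemma has_real_derivative_along_line:
  assumes "(f has_derivative f') (at (x + t *\<^sub>R b))"
  shows "((\<lambda>t. f (x + t *\<^sub>R b)) has_real_derivative f' b) (at t)"
proof -
  have "((\<lambda>t. f (x + t *\<^sub>R b)) has_derivative (\<lambda>h. f' (h *\<^sub>R b))) (at t)"
    by (rule has_derivative_compose[of "\<lambda>t. x + t *\<^sub>R b" "\<lambda>h. h *\<^sub>R b" t UNIV f f', OF _ assms])
       (auto intro!: derivative_eq_intros)
  moreover have "(\<lambda>h. f' (h *\<^sub>R b)) = (\<lambda>h. f' b * h)"
    using linear_cmul[OF has_derivative_linear[OF assms]] by (auto simp: mult.commute)
  ultimately show ?thesis by (simp add: has_field_derivative_def)
qed

text \<open>Two applications of the mean value theorem, to g(t) + g(-t) and then to g' on a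
  symmetric interval, turn the second difference into a second derivative. Steps below \<eta> from
  \<open>ball x0 \<eta>\<close> stay in the compact ball of radius 2\<eta>, where one bound serves
  all \<open>x\<close>.\<close>

lemma Ck_on_second_difference_bound:
  fixes u :: "'a::euclidean_space \<Rightarrow> real"
  assumes "Ck_on 2 (ball x0 (3 * \<eta>)) u" "b \<in> Basis" "0 < \<eta>"
  shows "\<exists>M. \<forall>x\<in>ball x0 \<eta>. \<forall>r. \<bar>r\<bar> < \<eta> \<longrightarrow> \<bar>second_difference u b x r\<bar> \<le> M * r\<^sup>2"
proof -
  from assms(1) obtain f' where f': "\<And>x. x \<in> ball x0 (3 * \<eta>) \<Longrightarrow> (u has_derivative f' x) (at x)"
    and C1: "\<And>b. b \<in> Basis \<Longrightarrow> Ck_on 1 (ball x0 (3 * \<eta>)) (\<lambda>x. f' x b)"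
    unfolding numeral_2_eq_2 by (elim Ck_on_SucE) (rule that, unfold One_nat_def)
  from C1[OF assms(2)] obtain f'' where
    f'': "\<And>x. x \<in> ball x0 (3 * \<eta>) \<Longrightarrow> ((\<lambda>x. f' x b) has_derivative f'' x) (at x)"
    and C0: "\<And>b. b \<in> Basis \<Longrightarrow> Ck_on 0 (ball x0 (3 * \<eta>)) (\<lambda>x. f'' x b)"
    unfolding One_nat_def by (elim Ck_on_SucE) (rule that)
  have "continuous_on (cball x0 (2 * \<eta>)) (\<lambda>x. f'' x b)"
    using C0[OF assms(2)] assms(3) by (auto intro: continuous_on_subset)
  then have "bounded ((\<lambda>x. f'' x b) ` cball x0 (2 * \<eta>))"
    by (intro compact_imp_bounded compact_continuous_image) auto
  then obtain M where M: "0 < M" "\<And>x. x \<in> cball x0 (2 * \<eta>) \<Longrightarrow> \<bar>f'' x b\<bar> \<le> M"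
    by (auto simp: bounded_pos)
  have pos: "\<bar>second_difference u b x r\<bar> \<le> (2 * M) * r\<^sup>2"
    if x: "x \<in> ball x0 \<eta>" and r: "0 < r" "r < \<eta>" for x r
  proof -
    have line: "x + t *\<^sub>R b \<in> cball x0 (2 * \<eta>)" if "\<bar>t\<bar> < \<eta>" for t
    proof -
      have "dist x0 (x + t *\<^sub>R b) \<le> dist x0 x + dist x (x + t *\<^sub>R b)" by (rule dist_triangle)
      also have "dist x (x + t *\<^sub>R b) = \<bar>t\<bar>" using assms(2) by (simp add: dist_norm)
      finally show ?thesis using that x by simp
    qed
    have line': "x + t *\<^sub>R b \<in> ball x0 (3 * \<eta>)" if "\<bar>t\<bar> < \<eta>" for t
      using line[OF that] assms(3) by auto
    define g where "g t = u (x + t *\<^sub>R b)" for t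
    define g' where "g' t = f' (x + t *\<^sub>R b) b" for t
    define g'' where "g'' t = f'' (x + t *\<^sub>R b) b" for t
    have g: "(g has_real_derivative g' t) (at t)" if "\<bar>t\<bar> < \<eta>" for t
      unfolding g_def g'_def by (intro has_real_derivative_along_line f' line' that)
    have g1: "(g' has_real_derivative g'' t) (at t)" if "\<bar>t\<bar> < \<eta>" for t
      unfolding g''_def g'_def by (intro has_real_derivative_along_line f'' line' that)
    have "\<exists>\<xi>. 0 < \<xi> \<and> \<xi> < r \<and> (g r + g (- r)) - (g 0 + g (- 0)) = (r - 0) * (g' \<xi> - g' (- \<xi>))"
    proof (rule MVT2[OF r(1)])
      fix t assume "0 \<le> t" "t \<le> r"
      then have t: "\<bar>t\<bar> < \<eta>" "\<bar>- t\<bar> < \<eta>" using r by auto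
      have "((\<lambda>t. g (- t)) has_real_derivative - g' (- t)) (at t)"
        using g[OF t(2)] DERIV_mirror by blast
      from DERIV_add[OF g[OF t(1)] this]
      show "((\<lambda>t. g t + g (- t)) has_real_derivative g' t - g' (- t)) (at t)" by simp
    qed
    then obtain \<xi> where \<xi>: "0 < \<xi>" "\<xi> < r" "g r + g (- r) - 2 * g 0 = r * (g' \<xi> - g' (- \<xi>))"
      by auto
    have "\<exists>\<zeta>. - \<xi> < \<zeta> \<and> \<zeta> < \<xi> \<and> g' \<xi> - g' (- \<xi>) = (\<xi> - (- \<xi>)) * g'' \<zeta>"
      using \<xi> r by (intro MVT2 g1) auto
    then obtain \<zeta> where \<zeta>: "- \<xi> < \<zeta>" "\<zeta> < \<xi>" "g' \<xi> - g' (- \<xi>) = 2 * \<xi> * g'' \<zeta>"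
      by auto
    have "\<bar>second_difference u b x r\<bar> = r * (2 * \<xi> * \<bar>g'' \<zeta>\<bar>)"
      using \<xi> \<zeta> r by (simp add: second_difference_def g_def abs_mult)
    also have "\<dots> \<le> r * (2 * r * M)"
      using M \<xi> \<zeta> r line[of \<zeta>] unfolding g''_def
      by (intro mult_left_mono mult_mono) auto
    finally show ?thesis by (simp add: power2_eq_square mult_ac)
  qed
  show ?thesis
  proof (intro exI[of _ "2 * M"] ballI allI impI)
    fix x r assume x: "x \<in> ball x0 \<eta>" and "\<bar>r\<bar> < \<eta>"
    \<comment> \<open>Negative \<open>r\<close> reduce to positive ones by evenness; at
      \<open>r = 0\<close> both sides vanish.\<close>
    then show "\<bar>second_difference u b x r\<bar> \<le> (2 * M) * r\<^sup>2"
      using pos[OF x, of r] pos[OF x, of "- r"]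
      by (cases r "0::real" rule: linorder_cases) (auto simp: second_difference_minus second_difference_def)
  qed
qed

section \<open>Integrable majorants and continuity of the directional integrals\<close>

lemma set_integrable_powr_from_0:
  assumes "-1 < a" "0 < \<eta>"
  shows "set_integrable lborel {0..\<eta>} (\<lambda>r::real. r powr a)"
proof -
  have "(\<lambda>r. r powr a) absolutely_integrable_on {0..\<eta>}"
    using assms by (intro nonnegative_absolutely_integrable_1 integrable_on_powr_from_0) auto
  then show ?thesis
    unfolding set_integrable_def by (subst (asm) integrable_completion) auto
qed

lemma set_integrable_powr_to_inf:
  assumes "a < -1" "0 < \<eta>"
  shows "set_integrable lborel {\<eta>..} (\<lambda>r::real. r powr a)"
proof -
  have "(\<lambda>r. r powr a) absolutely_integrable_on {\<eta>..}"
    using has_integral_powr_to_inf[of a \<eta>] assms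
    by (intro nonnegative_absolutely_integrable_1) (auto simp: has_integral_integrable_integral)
  then show ?thesis
    unfolding set_integrable_def by (subst (asm) integrable_completion) auto
qed

definition kernel_bound :: "real \<Rightarrow> real \<Rightarrow> real \<Rightarrow> real \<Rightarrow> real \<Rightarrow> real" where
  "kernel_bound s \<eta> M B r = (if \<bar>r\<bar> < \<eta> then M * r\<^sup>2 else B) / \<bar>r\<bar> powr (1 + 2 * s)"

text \<open>Near 0 the majorant is a multiple of |r|^(1-2s), integrable since s < 1; far away it is
  a multiple of |r|^(-1-2s), integrable since s > 0.\<close>

lemma integrable_kernel_bound:
  assumes "0 < s" "s < 1" "0 < \<eta>"
  shows "integrable lborel (kernel_bound s \<eta> M B)"
proof -
  \<comment> \<open>\<open>f\<close> lives on the half line; adding its reflection yields the even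
    kernel.\<close>
  define f where "f r = M * (indicator {0..<\<eta>} r *\<^sub>R r powr (1 - 2 * s)) + B * (indicator {\<eta>..} r *\<^sub>R r powr (- 1 - 2 * s))"
    for r :: real
  have "integrable lborel f"
    using set_integrable_subset[OF set_integrable_powr_from_0[of "1 - 2 * s" \<eta>], of "{0..<\<eta>}", OF _ _ _ atLeastLessThan_subseteq_atLeastAtMost_iff[THEN iffD2]]
      set_integrable_powr_to_inf[of "- 1 - 2 * s" \<eta>] assms
    unfolding f_def set_integrable_def
    by (intro Bochner_Integration.integrable_add integrable_mult_right) auto
  then have "integrable lborel (\<lambda>r. f r + f (- r))"
    using lborel_integrable_real_affine[of f "-1" 0] by auto
  moreover have "kernel_bound s \<eta> M B = (\<lambda>r. f r + f (- r))"
  proof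
    fix r :: real
    have "(r\<^sup>2) / \<bar>r\<bar> powr (1 + 2 * s) = \<bar>r\<bar> powr (1 - 2 * s)"
    proof (cases "r = 0")
      case False
      have "r\<^sup>2 = \<bar>r\<bar> powr 2" using False by (simp flip: powr_realpow)
      moreover have "2 - (1 + 2 * s) = 1 - 2 * s" by simp
      ultimately show ?thesis using powr_diff[of "\<bar>r\<bar>" 2 "1 + 2 * s"] by simp
    qed simp
    moreover have "1 / \<bar>r\<bar> powr (1 + 2 * s) = \<bar>r\<bar> powr (- 1 - 2 * s)"
      using powr_minus_divide[of "\<bar>r\<bar>" "1 + 2 * s"] by simp
    moreover have "kernel_bound s \<eta> M B r =
        (if \<bar>r\<bar> < \<eta> then M * (r\<^sup>2 / \<bar>r\<bar> powr (1 + 2 * s)) else B * (1 / \<bar>r\<bar> powr (1 + 2 * s)))"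
      by (simp add: kernel_bound_def)
    ultimately have "kernel_bound s \<eta> M B r =
        (if \<bar>r\<bar> < \<eta> then M * \<bar>r\<bar> powr (1 - 2 * s) else B * \<bar>r\<bar> powr (- 1 - 2 * s))"
      by simp
    then show "kernel_bound s \<eta> M B r = f r + f (- r)"
      using assms(3) by (cases r "0::real" rule: linorder_cases) (auto simp: f_def indicator_def)
  qed
  ultimately show ?thesis by simp
qed

lemma second_difference_kernel_bound:
  assumes "\<And>y. \<bar>u y\<bar> \<le> B" "\<bar>r\<bar> < \<eta> \<Longrightarrow> \<bar>second_difference u b x r\<bar> \<le> M * r\<^sup>2"
  shows "\<bar>second_difference u b x r / \<bar>r\<bar> powr (1 + 2 * s)\<bar> \<le> kernel_bound s \<eta> M (4 * B) r"
proof -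
  have "\<bar>second_difference u b x r\<bar> \<le> 4 * B"
    unfolding second_difference_def
    using assms(1)[of x] assms(1)[of "x + r *\<^sub>R b"] assms(1)[of "x - r *\<^sub>R b"] by linarith
  then show ?thesis
    using assms(2) by (auto simp: kernel_bound_def abs_divide intro: divide_right_mono)
qed

text \<open>Dominated convergence with a single majorant for all points near \<open>x0\<close>.
  Integrability ensures that the integrals do not take the default value 0; continuity later turns
  essential bounds into bounds at chosen points.\<close>

lemma directional_integral_continuous:
  fixes u :: "'a::euclidean_space \<Rightarrow> real"
  assumes s: "0 < s" "s < 1" and u: "continuous_on UNIV u" "\<And>y. \<bar>u y\<bar> \<le> B"
    and S: "Ck_on 2 S u" "open S" "x0 \<in> S" and b: "b \<in> Basis"
  shows "integrable lborel (\<lambda>r. second_difference u b x0 r / \<bar>r\<bar> powr (1 + 2 * s))" (is ?I)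
    and "isCont (\<lambda>x. LINT r|lborel. second_difference u b x r / \<bar>r\<bar> powr (1 + 2 * s)) x0" (is ?C)
proof -
  obtain e where e: "0 < e" "ball x0 e \<subseteq> S" using S openE by blast
  define \<eta> where "\<eta> = e / 3"
  have \<eta>: "0 < \<eta>" "Ck_on 2 (ball x0 (3 * \<eta>)) u"
    using e S(1) by (auto simp: \<eta>_def intro: Ck_on_subset)
  obtain M where M: "\<And>x r. x \<in> ball x0 \<eta> \<Longrightarrow> \<bar>r\<bar> < \<eta> \<Longrightarrow> \<bar>second_difference u b x r\<bar> \<le> M * r\<^sup>2"
    using Ck_on_second_difference_bound[OF \<eta>(2) b \<eta>(1)] by blast
  have [measurable]: "u \<in> borel_measurable borel"
    by (rule borel_measurable_continuous_onI[OF u(1)])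
  have meas[measurable]: "(\<lambda>r. second_difference u b x r / \<bar>r\<bar> powr (1 + 2 * s)) \<in> borel_measurable lborel" for x
    unfolding second_difference_def by measurable
  have bound: "\<bar>second_difference u b x r / \<bar>r\<bar> powr (1 + 2 * s)\<bar> \<le> kernel_bound s \<eta> M (4 * B) r"
    if "x \<in> ball x0 \<eta>" for x r
    by (rule second_difference_kernel_bound[OF u(2) M[OF that]])
  show ?I
    by (rule Bochner_Integration.integrable_bound[OF integrable_kernel_bound[OF s \<eta>(1), of M "4 * B"] meas])
       (use bound[of x0] \<eta>(1) in \<open>auto intro!: AE_I2 order_trans[OF _ abs_ge_self]\<close>)
  show ?C
    unfolding continuous_at_sequentially
  proof (intro allI impI, unfold o_def)
    fix X assume X: "X \<longlonglongrightarrow> x0"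
    then have "\<forall>\<^sub>F k in sequentially. X k \<in> ball x0 \<eta>"
      using \<eta>(1) by (simp add: tendsto_iff dist_commute)
    \<comment> \<open>The majorant is available only near \<open>x0\<close>, so the sequence is
      shifted past its first \<open>N\<close> terms.\<close>
    then obtain N where N: "\<And>k. N \<le> k \<Longrightarrow> X k \<in> ball x0 \<eta>"
      by (auto simp: eventually_sequentially)
    have "(\<lambda>k. LINT r|lborel. second_difference u b (X (k + N)) r / \<bar>r\<bar> powr (1 + 2 * s))
        \<longlonglongrightarrow> (LINT r|lborel. second_difference u b x0 r / \<bar>r\<bar> powr (1 + 2 * s))"
    proof (rule integral_dominated_convergence[where w="kernel_bound s \<eta> M (4 * B)"])
      show "AE r in lborel. norm (second_difference u b (X (k + N)) r / \<bar>r\<bar> powr (1 + 2 * s)) \<le> kernel_bound s \<eta> M (4 * B) r" for k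
        using bound[OF N[of "k + N"]] by auto
      have cont: "isCont u y" for y
        using u(1) by (auto simp: continuous_on_eq_continuous_at)
      show "AE r in lborel. (\<lambda>k. second_difference u b (X (k + N)) r / \<bar>r\<bar> powr (1 + 2 * s))
          \<longlonglongrightarrow> second_difference u b x0 r / \<bar>r\<bar> powr (1 + 2 * s)"
        unfolding second_difference_def divide_inverse
        using LIMSEQ_ignore_initial_segment[OF X, of N]
        by (intro AE_I2 tendsto_intros isCont_tendsto_compose[OF cont])
    qed (use meas integrable_kernel_bound[OF s \<eta>(1)] in auto)
    then show "(\<lambda>k. LINT r|lborel. second_difference u b (X k) r / \<bar>r\<bar> powr (1 + 2 * s))
        \<longlonglongrightarrow> (LINT r|lborel. second_difference u b x0 r / \<bar>r\<bar> powr (1 + 2 * s))"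
      by (rule LIMSEQ_offset)
  qed
qed

text \<open>A violation of the essential bound at a continuity point would persist on a nonempty
  open set, which is not negligible.\<close>

lemma Linfty_bound_at_isCont:
  assumes "f \<in> Linfty \<Omega>" "open \<Omega>"
  obtains C where "\<And>x. x \<in> \<Omega> \<Longrightarrow> isCont f x \<Longrightarrow> \<bar>f x\<bar> \<le> C"
proof -
  from assms(1) obtain C where "AE x in lebesgue_on \<Omega>. \<bar>f x\<bar> \<le> C" by (auto simp: Linfty_def)
  then have "AE x in lebesgue. x \<in> \<Omega> \<longrightarrow> \<bar>f x\<bar> \<le> C"
    using assms(2) by (subst (asm) AE_restrict_space_iff) auto
  then obtain N where "N \<in> null_sets lebesgue" "{x \<in> space lebesgue. \<not> (x \<in> \<Omega> \<longrightarrow> \<bar>f x\<bar> \<le> C)} \<subseteq> N"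
    unfolding eventually_ae_filter by blast
  then have N: "N \<in> null_sets lebesgue" "\<And>x. x \<notin> N \<Longrightarrow> x \<in> \<Omega> \<Longrightarrow> \<bar>f x\<bar> \<le> C"
    by auto
  have "\<bar>f x\<bar> \<le> C" if x: "x \<in> \<Omega>" "isCont f x" for x
  proof (rule ccontr)
    assume *: "\<not> \<bar>f x\<bar> \<le> C"
    have "isCont (\<lambda>x. \<bar>f x\<bar>) x" using x(2) by (intro continuous_intros)
    then have "((\<lambda>x. \<bar>f x\<bar>) \<longlongrightarrow> \<bar>f x\<bar>) (nhds x)"
      unfolding isCont_def by (rule tendsto_at_iff_tendsto_nhds[THEN iffD1])
    then have "\<forall>\<^sub>F y in nhds x. C < \<bar>f y\<bar>"
      using * by (intro order_tendstoD(1)) auto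
    then obtain U where U: "open U" "x \<in> U" "\<And>y. y \<in> U \<Longrightarrow> C < \<bar>f y\<bar>"
      by (auto simp: eventually_nhds)
    have "U \<inter> \<Omega> \<subseteq> N" using U N(2) by fastforce
    then have "negligible (U \<inter> \<Omega>)"
      using N(1) negligible_iff_null_sets negligible_subset by blast
    then show False
      using open_not_negligible[of "U \<inter> \<Omega>"] U x assms(2) by auto
  qed
  then show ?thesis by (rule that)
qed

section \<open>The logarithmic divergence\<close>

lemma norm_axis_combination:
  assumes "e \<in> Basis" "b \<in> Basis" "b \<noteq> e"
  shows "norm (t *\<^sub>R e + r *\<^sub>R b) = sqrt (t\<^sup>2 + r\<^sup>2)"
  using assms by (simp add: norm_eq_sqrt_inner inner_add_left inner_add_right inner_Basis power2_eq_square)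

section \<open>Second differences near the two spheres\<close>

context
  fixes s \<rho> \<epsilon> r :: real and u :: "'a::euclidean_space \<Rightarrow> real" and e :: 'a
  assumes s: "0 < s" and e: "e \<in> Basis" and \<rho>: "\<rho> \<le> 1/2"
    and inner: "\<And>x. dist e x < \<rho> \<Longrightarrow> u x = max 0 (norm x - 1) powr s"
    and outer: "\<And>x. dist (2 *\<^sub>R e) x < \<rho> \<Longrightarrow> u x = max 0 (2 - norm x) powr s"
    and \<epsilon>: "0 < \<epsilon>" "\<epsilon> < \<rho> / 2" and r: "\<bar>r\<bar> < \<rho> / 2"
begin

lemma near_inner:
  assumes "b \<in> Basis" "\<bar>t\<bar> < \<rho> / 2"
  shows "u ((1 + \<epsilon>) *\<^sub>R e + t *\<^sub>R b) = max 0 (norm ((1 + \<epsilon>) *\<^sub>R e + t *\<^sub>R b) - 1) powr s"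
proof (rule inner)
  have "dist e ((1 + \<epsilon>) *\<^sub>R e + t *\<^sub>R b) = norm (\<epsilon> *\<^sub>R e + t *\<^sub>R b)"
    by (simp add: dist_norm algebra_simps norm_minus_commute)
  also have "\<dots> \<le> \<epsilon> + \<bar>t\<bar>"
    using norm_triangle_ineq[of "\<epsilon> *\<^sub>R e" "t *\<^sub>R b"] e assms(1) \<epsilon>(1) by simp
  finally show "dist e ((1 + \<epsilon>) *\<^sub>R e + t *\<^sub>R b) < \<rho>" using \<epsilon>(2) assms(2) by simp
qed

lemma near_outer:
  assumes "b \<in> Basis" "\<bar>t\<bar> < \<rho> / 2"
  shows "u ((2 - \<epsilon>) *\<^sub>R e + t *\<^sub>R b) = max 0 (2 - norm ((2 - \<epsilon>) *\<^sub>R e + t *\<^sub>R b)) powr s"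
proof (rule outer)
  have "dist (2 *\<^sub>R e) ((2 - \<epsilon>) *\<^sub>R e + t *\<^sub>R b) = norm (\<epsilon> *\<^sub>R e - t *\<^sub>R b)"
    by (simp add: dist_norm algebra_simps)
  also have "\<dots> \<le> \<epsilon> + \<bar>t\<bar>"
    using norm_triangle_ineq4[of "\<epsilon> *\<^sub>R e" "t *\<^sub>R b"] e assms(1) \<epsilon>(1) by simp
  finally show "dist (2 *\<^sub>R e) ((2 - \<epsilon>) *\<^sub>R e + t *\<^sub>R b) < \<rho>" using \<epsilon>(2) assms(2) by simp
qed

lemma at_inner: "u ((1 + \<epsilon>) *\<^sub>R e) = \<epsilon> powr s"
  using near_inner[OF e, of 0] e \<epsilon> by simp

lemma at_outer: "u ((2 - \<epsilon>) *\<^sub>R e) = \<epsilon> powr s"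
  using near_outer[OF e, of 0] e \<epsilon> \<rho> by simp

text \<open>Along \<open>e\<close> the norm is affine, so \<open>u\<close> is the power of the
  positive part of \<epsilon> + t at the inner point and of \<epsilon> - t at the outer one. The
  symmetric second difference does not see the reflection of t.\<close>

lemma second_difference_normal:
  "second_difference u e ((1 + \<epsilon>) *\<^sub>R e) r = second_difference u e ((2 - \<epsilon>) *\<^sub>R e) r"
proof -
  have i: "u ((1 + \<epsilon>) *\<^sub>R e + t *\<^sub>R e) = max 0 (\<epsilon> + t) powr s"
    and o: "u ((2 - \<epsilon>) *\<^sub>R e + t *\<^sub>R e) = max 0 (\<epsilon> - t) powr s" if "\<bar>t\<bar> < \<rho> / 2" for t
    using near_inner[OF e that] near_outer[OF e that] that e \<epsilon> \<rho>
    by (simp_all flip: scaleR_left_distrib)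
  show ?thesis
    using i[of r] i[of "- r"] o[of r] o[of "- r"] r at_inner at_outer
    by (simp add: second_difference_def)
qed

text \<open>By Pythagoras a tangential step increases the norm: it leads away from the inner sphere
  but towards or across the outer one.\<close>

lemma second_difference_tangential:
  assumes "b \<in> Basis" "b \<noteq> e"
  shows "2 * ((\<epsilon> + r\<^sup>2 / 4) powr s - \<epsilon> powr s) \<le> second_difference u b ((1 + \<epsilon>) *\<^sub>R e) r"
    and "second_difference u b ((2 - \<epsilon>) *\<^sub>R e) r \<le> 0"
proof -
  have "(\<epsilon> + t\<^sup>2 / 4) powr s \<le> u ((1 + \<epsilon>) *\<^sub>R e + t *\<^sub>R b)" if t: "\<bar>t\<bar> < \<rho> / 2" for t
  proof -
    have "t\<^sup>2 \<le> 1"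
      using t \<rho> by (simp add: abs_square_le_1)
    \<comment> \<open>After expanding (1 + \<epsilon> + t^2/4)^2 and cancelling, what remains is
      this inequality times t^2; the factor 1/4 leaves room because \<epsilon> < 1/4.\<close>
    then have "(1 + \<epsilon>) / 2 + t\<^sup>2 / 16 \<le> 1"
      using \<epsilon> \<rho> by argo
    then have "t\<^sup>2 * ((1 + \<epsilon>) / 2 + t\<^sup>2 / 16) \<le> t\<^sup>2 * 1"
      by (intro mult_left_mono) auto
    then have "(1 + \<epsilon> + t\<^sup>2 / 4)\<^sup>2 \<le> (1 + \<epsilon>)\<^sup>2 + t\<^sup>2"
      by (simp add: power2_eq_square algebra_simps add_divide_distrib)
    then have "1 + \<epsilon> + t\<^sup>2 / 4 \<le> sqrt ((1 + \<epsilon>)\<^sup>2 + t\<^sup>2)"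
      by (rule real_le_rsqrt)
    then show ?thesis
      unfolding near_inner[OF assms(1) t] norm_axis_combination[OF e assms]
      using \<epsilon> s by (intro powr_mono2) auto
  qed
  from this[of r] this[of "- r"]
  show "2 * ((\<epsilon> + r\<^sup>2 / 4) powr s - \<epsilon> powr s) \<le> second_difference u b ((1 + \<epsilon>) *\<^sub>R e) r"
    using r at_inner by (simp add: second_difference_def)
  have "u ((2 - \<epsilon>) *\<^sub>R e + t *\<^sub>R b) \<le> \<epsilon> powr s" if t: "\<bar>t\<bar> < \<rho> / 2" for t
  proof -
    have "max 0 (2 - sqrt ((2 - \<epsilon>)\<^sup>2 + t\<^sup>2)) \<le> \<epsilon>"
      using \<epsilon>(1) real_sqrt_sum_squares_ge1[of "2 - \<epsilon>" t] by linarith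
    then show ?thesis
      unfolding near_outer[OF assms(1) t] norm_axis_combination[OF e assms]
      using s by (intro powr_mono2) auto
  qed
  from this[of r] this[of "- r"]
  show "second_difference u b ((2 - \<epsilon>) *\<^sub>R e) r \<le> 0"
    using r at_outer by (simp add: second_difference_def)
qed

end

text \<open>The term c/r carries the logarithm and \<open>k\<close> collects the integrable error;
  directions without divergence take \<open>c = 0\<close>.\<close>

lemma integral_lower_bound_log:
  fixes f k :: "real \<Rightarrow> real"
  assumes f: "integrable lborel f" and k: "integrable lborel k" and a: "0 < a" "a \<le> a'"
    and le: "\<And>r. c * (1 / r * indicator {a..a'} r) - k r \<le> f r"
  shows "c * ln (a' / a) - integral\<^sup>L lborel k \<le> integral\<^sup>L lborel f"
proof -
  have "has_bochner_integral lborel (\<lambda>r. 1 / r * indicator {a..a'} r) (ln a' - ln a)"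
    using a by (intro has_bochner_integral_FTC_Icc_real[where F=ln])
      (auto intro!: derivative_eq_intros continuous_intros)
  then have log: "integrable lborel (\<lambda>r. 1 / r * indicator {a..a'} r)"
      "(LINT r|lborel. 1 / r * indicator {a..a'} r) = ln (a' / a)"
    using a by (auto simp: has_bochner_integral_iff ln_div)
  have "(LINT r|lborel. c * (1 / r * indicator {a..a'} r) - k r) \<le> integral\<^sup>L lborel f"
    using f k log(1) le
    by (intro integral_mono Bochner_Integration.integrable_diff integrable_mult_right) auto
  moreover have "(LINT r|lborel. c * (1 / r * indicator {a..a'} r) - k r) = c * ln (a' / a) - integral\<^sup>L lborel k"
    using k log by (subst Bochner_Integration.integral_diff) (auto simp del: times_divide_eq_left)
  ultimately show ?thesis by simp
qed

text \<open>Continuity is pasted from the closed sets \<open>closure \<Omega>\<close>, where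
  \<open>d\<close> has a smooth extension, and \<open>- \<Omega>\<close>, where it vanishes.\<close>

lemma regularized_distance_continuous:
  assumes "regularized_distance \<Omega> d" "open \<Omega>"
  shows "continuous_on UNIV d"
proof -
  from assms(1) obtain U g where "closure \<Omega> \<subseteq> U" "smooth_on U g" "\<forall>x\<in>closure \<Omega>. d x = g x"
    unfolding regularized_distance_def smooth_on_closed_def by blast
  moreover from this have "continuous_on U g"
    unfolding smooth_on_def by (metis Ck_on.simps(1))
  ultimately have "continuous_on (closure \<Omega>) d"
    using continuous_on_cong[of "closure \<Omega>" "closure \<Omega>" d g] continuous_on_subset by metis
  moreover have "continuous_on (- \<Omega>) d"
    using assms(1) continuous_on_cong[of "- \<Omega>" "- \<Omega>" d "\<lambda>_. 0"] by (auto simp: regularized_distance_def)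
  ultimately have "continuous_on (closure \<Omega> \<union> - \<Omega>) d"
    using assms(2) by (intro continuous_on_closed_Un) auto
  moreover have "closure \<Omega> \<union> - \<Omega> = UNIV" using closure_subset[of \<Omega>] by blast
  ultimately show ?thesis by simp
qed

text \<open>From \<open>r = a\<close> on, \<epsilon>^s is at most half of (r^2/4)^s, so the doubled
  increment is at least (r^2/4)^s; division by r^(1+2s) leaves a multiple of 1/r.\<close>

lemma powr_increment_lower_bound:
  fixes s a r \<epsilon> :: real
  assumes "0 < s" "0 < a" "a \<le> r" "0 \<le> \<epsilon>" "2 * \<epsilon> powr s \<le> (a\<^sup>2 / 4) powr s"
  shows "(1 / 4) powr s / r \<le> 2 * ((\<epsilon> + r\<^sup>2 / 4) powr s - \<epsilon> powr s) / r powr (1 + 2 * s)"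
proof -
  have "(a\<^sup>2 / 4) powr s \<le> (r\<^sup>2 / 4) powr s" "(r\<^sup>2 / 4) powr s \<le> (\<epsilon> + r\<^sup>2 / 4) powr s"
    using assms by (auto intro!: powr_mono2 power_mono divide_right_mono)
  then have "(r\<^sup>2 / 4) powr s \<le> 2 * ((\<epsilon> + r\<^sup>2 / 4) powr s - \<epsilon> powr s)"
    using assms(5) by argo
  moreover have "(r\<^sup>2 / 4) powr s = (1 / 4) powr s / r * r powr (1 + 2 * s)"
  proof -
    have "r\<^sup>2 = r powr 2" using powr_realpow[of r 2] assms by simp
    then have "(r\<^sup>2) powr s = r powr (2 * s)" by (simp only: powr_powr)
    then show ?thesis
      using assms by (simp add: powr_divide powr_add)
  qed
  ultimately show ?thesis
    using assms by (subst pos_le_divide_eq) auto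
qed

lemma stable_operator_annulus_unbounded:
  fixes d :: "'a::euclidean_space \<Rightarrow> real"
  assumes s: "0 < s" "s < 1" and dim: "2 \<le> DIM('a)" and d: "regularized_distance annulus d"
  shows "stable_operator s axis_measure (\<lambda>x. d x powr s) \<notin> Linfty annulus"
proof
  define u where "u x = d x powr s" for x
  define J where "J b x r = second_difference u b x r / \<bar>r\<bar> powr (1 + 2 * s)" for b x r
  assume "stable_operator s axis_measure (\<lambda>x. d x powr s) \<in> Linfty annulus"
  then obtain C where C: "\<And>x. x \<in> annulus \<Longrightarrow> isCont (stable_operator s axis_measure u) x \<Longrightarrow> \<bar>stable_operator s axis_measure u x\<bar> \<le> C"
    using Linfty_bound_at_isCont[OF _ open_annulus] unfolding u_def by blast
  have d0: "0 \<le> d x" "x \<notin> annulus \<Longrightarrow> d x = 0" for x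
    using d by (auto simp: regularized_distance_def)
  have cont: "continuous_on UNIV u"
    unfolding u_def using regularized_distance_continuous[OF d open_annulus] d0 s
    by (intro continuous_on_powr') auto
  have "compact (closure (annulus :: 'a set))" by (simp add: bounded_annulus)
  then have "bounded (u ` closure annulus)"
    using cont by (intro compact_imp_bounded compact_continuous_image) (auto intro: continuous_on_subset)
  then obtain B where B: "0 < B" "\<And>x. x \<in> closure annulus \<Longrightarrow> \<bar>u x\<bar> \<le> B"
    by (auto simp: bounded_pos)
  have bound: "\<bar>u x\<bar> \<le> B" for x
    using B d0(2)[of x] closure_subset[of "annulus :: 'a set"] by (cases "x \<in> annulus") (auto simp: u_def)
  obtain e :: 'a where e: "e \<in> Basis" using nonempty_Basis by blast
  \<comment> \<open>Dimension at least 2 enters here: the divergence needs a tangential direction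
    \<open>e'\<close>.\<close>
  have "\<not> Basis \<subseteq> {e}"
    using card_mono[of "{e}" "Basis :: 'a set"] dim by auto
  then obtain e' where e': "e' \<in> Basis" "e' \<noteq> e" by blast
  obtain V where V: "open V" "frontier annulus \<subseteq> V" "\<And>x. x \<in> V \<Longrightarrow> d x = infdist x (- annulus)"
    using d by (auto simp: regularized_distance_def)
  have "e \<in> V" "2 *\<^sub>R e \<in> V"
    using V(2) frontier_annulusI[of e] frontier_annulusI[of "2 *\<^sub>R e"] e by auto
  then obtain \<rho>1 \<rho>2 where \<rho>12: "0 < \<rho>1" "ball e \<rho>1 \<subseteq> V" "0 < \<rho>2" "ball (2 *\<^sub>R e) \<rho>2 \<subseteq> V"
    using V(1) by (meson openE)
  \<comment> \<open>The bound 1/2 keeps the two balls on their own sides of radius 3/2, where the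
    distance formulas apply.\<close>
  define \<rho> where "\<rho> = min (1/2) (min \<rho>1 \<rho>2)"
  have \<rho>: "0 < \<rho>" "\<rho> \<le> 1/2" "ball e \<rho> \<subseteq> V" "ball (2 *\<^sub>R e) \<rho> \<subseteq> V"
    using \<rho>12 by (auto simp: \<rho>_def)
  have inner: "u x = max 0 (norm x - 1) powr s" if "dist e x < \<rho>" for x
    using that \<rho> e V(3)[of x] infdist_annulus_inner[of x] norm_triangle_ineq2[of x e]
    by (auto simp: u_def dist_norm norm_minus_commute)
  have outer: "u x = max 0 (2 - norm x) powr s" if "dist (2 *\<^sub>R e) x < \<rho>" for x
    using that \<rho> e V(3)[of x] infdist_annulus_outer[of x] norm_triangle_ineq2[of "2 *\<^sub>R e" x]
    by (auto simp: u_def dist_norm norm_minus_commute)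
  have smooth_inner: "Ck_on 2 (ball e \<rho> \<inter> {x. 1 < norm x}) u" (is "Ck_on 2 ?S u")
  proof -
    have S: "open ?S" by (intro open_Int open_ball open_Collect_less continuous_intros)
    then have "Ck_on 2 ?S (\<lambda>x. (norm x - 1) powr s)"
      by (intro Ck_on_powr Ck_on_diff Ck_on_norm Ck_on_const) auto
    then show ?thesis
      by (rule Ck_on_cong[OF S, rotated]) (auto simp: inner)
  qed
  have smooth_outer: "Ck_on 2 (ball (2 *\<^sub>R e) \<rho> \<inter> {x. 1 < norm x} \<inter> {x. norm x < 2}) u" (is "Ck_on 2 ?S u")
  proof -
    have S: "open ?S" by (intro open_Int open_ball open_Collect_less continuous_intros)
    then have "Ck_on 2 ?S (\<lambda>x. (2 - norm x) powr s)"
      by (intro Ck_on_powr Ck_on_diff Ck_on_norm Ck_on_const) auto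
    then show ?thesis
      by (rule Ck_on_cong[OF S, rotated]) (auto simp: outer)
  qed
  have op: "stable_operator s axis_measure u = (\<lambda>x. \<Sum>b\<in>Basis. LINT r|lborel. J b x r)"
    using stable_operator_axis_measure[OF borel_measurable_continuous_onI[OF cont]] by (auto simp: J_def)
  \<comment> \<open>For |r| < \<rho>/2 the comparison has no error, hence the coefficient 0. Beyond,
    two second differences of at most 4B each give 8B.\<close>
  define k where "k = kernel_bound s (\<rho> / 2) 0 (8 * B)"
  define K where "K = integral\<^sup>L lborel k"
  have k: "integrable lborel k" unfolding k_def using s \<rho> by (intro integrable_kernel_bound) auto
  define c where "c = (1 / 4 :: real) powr s"
  have c: "0 < c" by (simp add: c_def)
  have main: "c * ln (\<rho> / 4 / a) - DIM('a) * K \<le> 2 * C" if a: "0 < a" "a \<le> \<rho> / 4" for a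
  proof -
    \<comment> \<open>The second entry makes 2 \<epsilon>^s at most (a^2/4)^s, as
      \<open>powr_increment_lower_bound\<close> asks; the first keeps both points in the region of
      the explicit formulas.\<close>
    define \<epsilon> where "\<epsilon> = min (\<rho> / 4) ((1 / 2) powr (1 / s) * (a\<^sup>2 / 4))"
    have \<epsilon>: "0 < \<epsilon>" "\<epsilon> < \<rho> / 2" "\<epsilon> \<le> 1/4" using a \<rho> by (auto simp: \<epsilon>_def)
    have "\<epsilon> powr s \<le> ((1 / 2) powr (1 / s) * (a\<^sup>2 / 4)) powr s"
      using \<epsilon> s by (intro powr_mono2) (auto simp: \<epsilon>_def)
    also have "\<dots> = 1 / 2 * (a\<^sup>2 / 4) powr s"
      using s by (subst powr_mult) (simp_all add: powr_powr)
    finally have \<epsilon>_small: "2 * \<epsilon> powr s \<le> (a\<^sup>2 / 4) powr s" by simp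
    define x where "x = (1 + \<epsilon>) *\<^sub>R e"
    define y where "y = (2 - \<epsilon>) *\<^sub>R e"
    have xy: "norm x = 1 + \<epsilon>" "norm y = 2 - \<epsilon>" using e \<epsilon> by (auto simp: x_def y_def)
    have "dist e x = \<epsilon>" "dist (2 *\<^sub>R e) y = \<epsilon>"
      using e \<epsilon> by (auto simp: x_def y_def dist_norm algebra_simps)
    then have x: "x \<in> ball e \<rho> \<inter> {x. 1 < norm x}" and y: "y \<in> ball (2 *\<^sub>R e) \<rho> \<inter> {x. 1 < norm x} \<inter> {x. norm x < 2}"
      using \<epsilon> xy \<rho>(1) by auto
    have op1: "open (ball e \<rho> \<inter> {x. 1 < norm x})" "open (ball (2 *\<^sub>R e) \<rho> \<inter> {x. 1 < norm x} \<inter> {x. norm x < 2})"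
      by (intro open_Int open_ball open_Collect_less continuous_intros)+
    note Jx = directional_integral_continuous[OF s cont bound smooth_inner op1(1) x, folded J_def]
    note Jy = directional_integral_continuous[OF s cont bound smooth_outer op1(2) y, folded J_def]
    have "isCont (stable_operator s axis_measure u) x" "isCont (stable_operator s axis_measure u) y"
      unfolding op using Jx(2) Jy(2) by (auto intro!: continuous_sum)
    then have "\<bar>stable_operator s axis_measure u x\<bar> \<le> C" "\<bar>stable_operator s axis_measure u y\<bar> \<le> C"
      using xy \<epsilon> by (auto intro!: C simp: annulus_def)
    then have "stable_operator s axis_measure u x - stable_operator s axis_measure u y \<le> 2 * C" by linarith
    moreover have "stable_operator s axis_measure u x - stable_operator s axis_measure u y
        = (\<Sum>b\<in>Basis. LINT r|lborel. J b x r - J b y r)"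
      unfolding op sum_subtractf[symmetric] using Jx(1) Jy(1)
      by (intro sum.cong refl Bochner_Integration.integral_diff[symmetric]) auto
    \<comment> \<open>Every direction costs at most \<open>K\<close>; only the gain from
      \<open>e'\<close> is retained, other tangential directions being bounded with coefficient
      0.\<close>
    moreover have "(\<Sum>b\<in>Basis. (if b = e' then c * ln (\<rho> / 4 / a) else 0) - K)
        \<le> (\<Sum>b\<in>Basis. LINT r|lborel. J b x r - J b y r)"
    proof (rule sum_mono)
      fix b :: 'a assume b: "b \<in> Basis"
      have "(if b = e' then c else 0) * ln (\<rho> / 4 / a) - K \<le> (LINT r|lborel. J b x r - J b y r)"
        unfolding K_def
      proof (rule integral_lower_bound_log[OF _ k a])
        show "integrable lborel (\<lambda>r. J b x r - J b y r)"
          using Jx(1)[OF b] Jy(1)[OF b] by simp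
        fix r :: real
        show "(if b = e' then c else 0) * (1 / r * indicator {a..\<rho> / 4} r) - k r \<le> J b x r - J b y r"
        proof (cases "\<bar>r\<bar> < \<rho> / 2")
          case False
          then have "\<not> r \<le> \<rho> / 4 \<or> r < 0" using \<rho>(1) by linarith
          then have "indicator {a..\<rho> / 4} r = (0::real)" using a by (auto simp: indicator_def)
          moreover have "\<bar>second_difference u b x r - second_difference u b y r\<bar> \<le> 8 * B"
            unfolding second_difference_def
            using bound[of x] bound[of "x + r *\<^sub>R b"] bound[of "x - r *\<^sub>R b"]
              bound[of y] bound[of "y + r *\<^sub>R b"] bound[of "y - r *\<^sub>R b"] by linarith
          then have "- (8 * B) / \<bar>r\<bar> powr (1 + 2 * s)
              \<le> (second_difference u b x r - second_difference u b y r) / \<bar>r\<bar> powr (1 + 2 * s)"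
            by (intro divide_right_mono) auto
          ultimately show ?thesis
            using False by (simp add: k_def kernel_bound_def J_def diff_divide_distrib)
        next
          case True
          then have k0: "k r = 0" by (simp add: k_def kernel_bound_def)
          note ctx = s(1) e \<rho>(2) inner outer \<epsilon>(1,2) True
          show ?thesis
          proof (cases "b = e")
            case True
            then show ?thesis
              using second_difference_normal[OF ctx] e' k0 by (simp add: J_def x_def y_def)
          next
            case False
            note tang = second_difference_tangential[OF ctx b False, folded x_def y_def]
            have "J b y r \<le> 0" using tang(2) by (simp add: J_def divide_nonpos_nonneg)
            moreover have "2 * ((\<epsilon> + r\<^sup>2 / 4) powr s - \<epsilon> powr s) / \<bar>r\<bar> powr (1 + 2 * s) \<le> J b x r"
              unfolding J_def using tang(1) by (intro divide_right_mono) auto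
            moreover have "(if b = e' then c else 0) * (1 / r * indicator {a..\<rho> / 4} r)
                \<le> 2 * ((\<epsilon> + r\<^sup>2 / 4) powr s - \<epsilon> powr s) / \<bar>r\<bar> powr (1 + 2 * s)"
            proof (cases "b = e' \<and> r \<in> {a..\<rho> / 4}")
              case True
              then show ?thesis
                using powr_increment_lower_bound[OF s(1) a(1) _ _ \<epsilon>_small, of r] a \<epsilon> by (simp add: c_def)
            next
              case False
              have "\<epsilon> powr s \<le> (\<epsilon> + r\<^sup>2 / 4) powr s"
                using \<epsilon> s by (intro powr_mono2) auto
              then show ?thesis using False by (auto simp: indicator_def)
            qed
            ultimately show ?thesis using k0 by linarith
          qed
        qed
      qed
      then show "(if b = e' then c * ln (\<rho> / 4 / a) else 0) - K \<le> (LINT r|lborel. J b x r - J b y r)"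
        by (auto split: if_splits)
    qed
    moreover have "(\<Sum>b\<in>Basis. (if b = e' then c * ln (\<rho> / 4 / a) else 0) - K) = c * ln (\<rho> / 4 / a) - DIM('a) * K"
      using e' by (simp add: sum_subtractf)
    ultimately show ?thesis by linarith
  qed
  \<comment> \<open>Taking \<open>a\<close> as \<rho>/4 times e^(-t) makes the logarithm equal to t,
    and this t pushes the lower bound above 2C.\<close>
  define t where "t = (\<bar>2 * C + DIM('a) * K\<bar> + 1) / c"
  have "0 \<le> t" using c by (simp add: t_def)
  then have "\<rho> / 4 * exp (- t) \<le> \<rho> / 4" using \<rho>(1) by simp
  moreover have "\<rho> / 4 / (\<rho> / 4 * exp (- t)) = exp t" using \<rho>(1) by (simp add: exp_minus inverse_eq_divide)
  ultimately have "c * t - DIM('a) * K \<le> 2 * C"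
    using main[of "\<rho> / 4 * exp (- t)"] \<rho>(1) by simp
  moreover have "c * t = \<bar>2 * C + DIM('a) * K\<bar> + 1" using c by (simp add: t_def)
  ultimately show False by linarith
qed

theorem proposition6p2:
  fixes s :: real
  assumes "0 < s" and "s < 1" and "2 \<le> CARD('n::finite)"
  shows "\<exists>(\<mu> :: (real^'n) measure) lam Lam (\<Omega> :: (real^'n) set).
           spectral_measure s lam Lam \<mu> \<and>
           smooth_bounded_domain \<Omega> \<and>
           (\<exists>d. regularized_distance \<Omega> d) \<and>
           (\<forall>d. regularized_distance \<Omega> d \<longrightarrow>
              stable_operator s \<mu> (\<lambda>x. d x powr s) \<notin> Linfty \<Omega>)"
proof -
  have dim: "2 \<le> DIM(real^'n)" using assms(3) by simp
  show ?thesis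
    using spectral_measure_axis_measure[OF assms(1,2)] smooth_bounded_domain_annulus[OF dim]
      regularized_distance_annulus_exists stable_operator_annulus_unbounded[OF assms(1,2) dim]
    by blast
qed

end
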